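(* For all data $\alpha,\beta$: if $\alpha\simeq_{RT}\beta$ then $\beta$ is deducible from $\alpha$ in RTDC.
   Context: Formulas are built from propositional variables with $\neg,\wedge,\vee$. A datum is a finite set of finite sets of formulas; its elements are called components. Notation: $\Gamma,A$ is $\Gamma\cup\{A\}$; $\Gamma,\Delta$ is $\Gamma\cup\Delta$; $\Gamma/\rho$ is $\{\Gamma\}\cup\rho$ and $\Gamma/\Delta/\rho$ is $\{\Gamma,\Delta\}\cup\rho$, etc., where $\rho$ is any datum (possibly empty, overlaps allowed). Rules of RTDC (each item is a pair of rules, allowing inference in both directions). G-rules: $\Gamma,A\wedge B/\rho$ and $\Gamma,A,B/\rho$; $\Gamma,A\vee B/\rho$ and $\Gamma,A/\Gamma,B/\rho$; $\Gamma,\neg\neg A/\rho$ and $\Gamma,A/\rho$; $\Gamma,\neg(A\vee B)/\rho$ and $\Gamma,\neg A,\neg B/\rho$; $\Gamma,\neg(A\wedge B)/\rho$ and $\Gamma,\neg A/\Gamma,\neg B/\rho$. S-rules: Fus: $\Gamma\,/\,\Delta\,/\,(\Gamma,\Delta)\,/\,\rho$ and $\Gamma/\Delta/\rho$; Int: $\Gamma\,/\,(\Gamma,\Delta)\,/\,(\Gamma,\Delta,\Theta)\,/\,\rho$ and $\Gamma\,/\,(\Gamma,\Delta,\Theta)\,/\,\rho$. A deduction of $\beta$ from $\alpha$ is a finite sequence of data starting with $\alpha$ and ending with $\beta$, each datum after the first being inferable from the immediately preceding one by a rule. Semantics. An elementary situation space is any set $S$; a state is a subset of $S$. For a set $X$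 of states, $\mathrm{Fus\,Cl}(X)=\{\bigcup Y: Y\subseteq X, Y\neq\varnothing\}$ and $\mathrm{Int\,Cl}(X)=\{\Sigma:\exists\Sigma_1,\Sigma_2\in X\ (\Sigma_1\subseteq\Sigma\subseteq\Sigma_2)\}$; write $C(X)=\mathrm{Int\,Cl}(\mathrm{Fus\,Cl}(X))$. A bilateral proposition is a pair $\langle X,Y\rangle$ of sets of states with $X\neq Y$; it is regular if both $X$ and $Y$ are non-empty, $X=\mathrm{Fus\,Cl}(X)=\mathrm{Int\,Cl}(X)$ and likewise for $Y$. A regular model $(S,\sigma)$ consists of an elementary situation space $S$ and a function $\sigma$ assigning a regular bilateral proposition $\sigma(p)=\langle\sigma^+(p),\sigma^-(p)\rangle$ to each propositional variable. $\sigma$ is extended to formulas by: $\sigma^+(\neg A)=\sigma^-(A)$, $\sigma^-(\neg A)=\sigma^+(A)$; $\sigma^+(A\wedge B)=C(\{\Sigma_1\cup\Sigma_2:\Sigma_1\in\sigma^+(A),\Sigma_2\in\sigma^+(B)\})$, $\sigma^-(A\wedge B)=C(\sigma^-(A)\cup\sigma^-(B))$; $\sigma^+(A\vee B)=C(\sigma^+(A)\cup\sigma^+(B))$, $\sigma^-(A\vee B)=C(\{\Sigma_1\cup\Sigma_2:\Sigma_1\in\sigma^-(A),\Sigma_2\in\sigma^-(B)\})$. Data are treated as the corresponding disjunctions of conjunctions: for a component $\Gamma$, $\sigma^+(\Gamma)=C(\{\bigcup_{A\in\Gamma}\Sigma_A:\Sigma_A\in\sigma^+(A)\})$ (so $\{\varnothing\}$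 if $\Gamma=\varnothing$), and $\sigma^+(\alpha)=C(\bigcup_{\Gamma\in\alpha}\sigma^+(\Gamma))$. Then $\alpha\simeq_{RT}\beta$ means: $\sigma^+(\alpha)=\sigma^+(\beta)$ for every regular model $(S,\sigma)$. *)

theory Defs
  imports Main "HOL-Library.FSet"
begin

section \<open>Formulas and data\<close>

datatype 'v formula =
    Var 'v
  | Neg "'v formula"
  | Conj "'v formula" "'v formula"
  | Disj "'v formula" "'v formula"

type_synonym 'v component = "'v formula fset"
type_synonym 'v datum = "'v component fset"


section \<open>The calculus RTDC\<close>

text \<open>
  The notation \<open>\<Gamma>,A\<close> is \<open>finsert A \<Gamma>\<close>, \<open>\<Gamma>,\<Delta>\<close> is \<open>\<Gamma> |\<union>| \<Delta>\<close>, and \<open>\<Gamma>/\<rho>\<close> is \<open>finsert \<Gamma> \<rho>\<close>.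
  No disjointness is imposed, so overlaps are allowed. Each clause relates the two data of one pair
  of rules; \<open>rtdc_infer\<close> below allows both directions.
\<close>

inductive rtdc_pair :: "'v datum \<Rightarrow> 'v datum \<Rightarrow> bool" where
  G_conj:
    "rtdc_pair (finsert (finsert (Conj A B) \<Gamma>) \<rho>)
               (finsert (finsert A (finsert B \<Gamma>)) \<rho>)"
| G_disj:
    "rtdc_pair (finsert (finsert (Disj A B) \<Gamma>) \<rho>)
               (finsert (finsert A \<Gamma>) (finsert (finsert B \<Gamma>) \<rho>))"
| G_neg_neg:
    "rtdc_pair (finsert (finsert (Neg (Neg A)) \<Gamma>) \<rho>)
               (finsert (finsert A \<Gamma>) \<rho>)"
| G_neg_disj:
    "rtdc_pair (finsert (finsert (Neg (Disj A B)) \<Gamma>) \<rho>)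
               (finsert (finsert (Neg A) (finsert (Neg B) \<Gamma>)) \<rho>)"
| G_neg_conj:
    "rtdc_pair (finsert (finsert (Neg (Conj A B)) \<Gamma>) \<rho>)
               (finsert (finsert (Neg A) \<Gamma>) (finsert (finsert (Neg B) \<Gamma>) \<rho>))"
| S_Fus:
    "rtdc_pair (finsert \<Gamma> (finsert \<Delta> (finsert (\<Gamma> |\<union>| \<Delta>) \<rho>)))
               (finsert \<Gamma> (finsert \<Delta> \<rho>))"
| S_Int:
    "rtdc_pair (finsert \<Gamma> (finsert (\<Gamma> |\<union>| \<Delta>) (finsert (\<Gamma> |\<union>| \<Delta> |\<union>| \<Theta>) \<rho>)))
               (finsert \<Gamma> (finsert (\<Gamma> |\<union>| \<Delta> |\<union>| \<Theta>) \<rho>))"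

definition rtdc_infer :: "'v datum \<Rightarrow> 'v datum \<Rightarrow> bool" where
  "rtdc_infer \<alpha> \<beta> \<longleftrightarrow> rtdc_pair \<alpha> \<beta> \<or> rtdc_pair \<beta> \<alpha>"

definition rtdc_deduction :: "'v datum \<Rightarrow> 'v datum \<Rightarrow> 'v datum list \<Rightarrow> bool" where
  "rtdc_deduction \<alpha> \<beta> ds \<longleftrightarrow>
     ds \<noteq> [] \<and> hd ds = \<alpha> \<and> last ds = \<beta> \<and> successively rtdc_infer ds"

definition rtdc_deducible :: "'v datum \<Rightarrow> 'v datum \<Rightarrow> bool" where
  "rtdc_deducible \<alpha> \<beta> \<longleftrightarrow> (\<exists>ds. rtdc_deduction \<alpha> \<beta> ds)"


section \<open>Regular models\<close>

definition Fus_Cl :: "'s set set \<Rightarrow> 's set set" where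
  "Fus_Cl X = {\<Union>Y | Y. Y \<subseteq> X \<and> Y \<noteq> {}}"

definition Int_Cl :: "'s set set \<Rightarrow> 's set set" where
  "Int_Cl X = {\<Sigma>. \<exists>\<Sigma>1\<in>X. \<exists>\<Sigma>2\<in>X. \<Sigma>1 \<subseteq> \<Sigma> \<and> \<Sigma> \<subseteq> \<Sigma>2}"

definition Cl :: "'s set set \<Rightarrow> 's set set" where
  "Cl X = Int_Cl (Fus_Cl X)"

definition bilateral_proposition :: "'s set \<Rightarrow> 's set set \<times> 's set set \<Rightarrow> bool" where
  "bilateral_proposition S P \<longleftrightarrow> fst P \<subseteq> Pow S \<and> snd P \<subseteq> Pow S \<and> fst P \<noteq> snd P"

definition regular_set :: "'s set set \<Rightarrow> bool" where
  "regular_set X \<longleftrightarrow> X \<noteq> {} \<and> X = Fus_Cl X \<and> X = Int_Cl X"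

definition regular_model :: "'s set \<Rightarrow> ('v \<Rightarrow> 's set set \<times> 's set set) \<Rightarrow> bool" where
  "regular_model S \<sigma> \<longleftrightarrow>
     (\<forall>p. bilateral_proposition S (\<sigma> p) \<and> regular_set (fst (\<sigma> p)) \<and> regular_set (snd (\<sigma> p)))"

fun sigma_pos :: "('v \<Rightarrow> 's set set \<times> 's set set) \<Rightarrow> 'v formula \<Rightarrow> 's set set"
  and sigma_neg :: "('v \<Rightarrow> 's set set \<times> 's set set) \<Rightarrow> 'v formula \<Rightarrow> 's set set" where
  "sigma_pos \<sigma> (Var p) = fst (\<sigma> p)"
| "sigma_pos \<sigma> (Neg A) = sigma_neg \<sigma> A"
| "sigma_pos \<sigma> (Conj A B) = Cl {\<Sigma>1 \<union> \<Sigma>2 | \<Sigma>1 \<Sigma>2. \<Sigma>1 \<in> sigma_pos \<sigma> A \<and> \<Sigma>2 \<in> sigma_pos \<sigma> B}"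
| "sigma_pos \<sigma> (Disj A B) = Cl (sigma_pos \<sigma> A \<union> sigma_pos \<sigma> B)"
| "sigma_neg \<sigma> (Var p) = snd (\<sigma> p)"
| "sigma_neg \<sigma> (Neg A) = sigma_pos \<sigma> A"
| "sigma_neg \<sigma> (Conj A B) = Cl (sigma_neg \<sigma> A \<union> sigma_neg \<sigma> B)"
| "sigma_neg \<sigma> (Disj A B) = Cl {\<Sigma>1 \<union> \<Sigma>2 | \<Sigma>1 \<Sigma>2. \<Sigma>1 \<in> sigma_neg \<sigma> A \<and> \<Sigma>2 \<in> sigma_neg \<sigma> B}"

definition sigma_component ::
    "('v \<Rightarrow> 's set set \<times> 's set set) \<Rightarrow> 'v component \<Rightarrow> 's set set" where
  "sigma_component \<sigma> \<Gamma> = Cl {\<Union>A\<in>fset \<Gamma>. f A | f. \<forall>A\<in>fset \<Gamma>. f A \<in> sigma_pos \<sigma> A}"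

definition sigma_datum ::
    "('v \<Rightarrow> 's set set \<times> 's set set) \<Rightarrow> 'v datum \<Rightarrow> 's set set" where
  "sigma_datum \<sigma> \<alpha> = Cl (\<Union>\<Gamma>\<in>fset \<alpha>. sigma_component \<sigma> \<Gamma>)"

text \<open>
  HOL cannot quantify over types inside a formula, so the type \<open>'s\<close> from which the elementary
  situation spaces are drawn is a parameter: \<open>S\<close> ranges over all sets of elements of \<open>'s\<close>. This
  relation gets weaker as \<open>'s\<close> gets smaller, so completeness for a smaller \<open>'s\<close> is the stronger
  statement.
\<close>

definition RT_equiv :: "'s itself \<Rightarrow> 'v datum \<Rightarrow> 'v datum \<Rightarrow> bool" where
  "RT_equiv _ \<alpha> \<beta> \<longleftrightarrow>
     (\<forall>(S :: 's set) \<sigma>. regular_model S \<sigma> \<longrightarrow> sigma_datum \<sigma> \<alpha> = sigma_datum \<sigma> \<beta>)"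

end

theory Submission imports Defs begin

text \<open>
  A state belongs to \<open>Cl X\<close> iff it extends some member of \<open>X\<close> and is contained in \<open>\<Union>X\<close>. Hence a
  proposition matters only through its union and its upward closure, on which conjunction and
  disjunction act pointwise, and soundness of all rules is immediate. The G-rules turn every datum
  into one made of literals. In the model where each literal is verified exactly by its own
  singleton, a literal datum denotes its own closure under \<open>Cl\<close>; and the S-rules allow
  precisely the members of that closure to be added to the datum. So two equivalent literal data
  \<open>\<alpha>\<close>, \<open>\<beta>\<close> are both interdeducible with their union.
\<close>

section \<open>Deducibility as an equivalence relation\<close>

text \<open>Every rule works in both directions, so deducibility is the equivalence closure of
  \<open>rtdc_pair\<close>; this form provides symmetry and transitivity for chained steps.\<close>

abbreviation interdeducible :: "'v datum \<Rightarrow> 'v datum \<Rightarrow> bool" (infix "\<approx>" 50) where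
  "\<alpha> \<approx> \<beta> \<equiv> equivclp rtdc_pair \<alpha> \<beta>"

lemma interdeducible_if_pair_rev: "rtdc_pair \<alpha> \<beta> \<Longrightarrow> \<beta> \<approx> \<alpha>"
  by (blast intro: r_into_equivclp equivclp_sym)

lemma rtdc_deducible_if_interdeducible:
  assumes "\<alpha> \<approx> \<beta>"
  shows "rtdc_deducible \<alpha> \<beta>"
  using assms
proof (induction rule: equivclp_induct)
  case base
  have "rtdc_deduction \<alpha> \<alpha> [\<alpha>]"
    by (simp add: rtdc_deduction_def)
  then show ?case
    unfolding rtdc_deducible_def by blast
next
  case (step \<beta> \<gamma>)
  then obtain ds where "rtdc_deduction \<alpha> \<beta> ds"
    unfolding rtdc_deducible_def by blast
  with step(2) have "rtdc_deduction \<alpha> \<gamma> (ds @ [\<gamma>])"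
    by (auto simp: rtdc_deduction_def successively_append_iff rtdc_infer_def)
  then show ?case
    unfolding rtdc_deducible_def by blast
qed

section \<open>Adding members of the closure\<close>

text \<open>Fus joins only two components at a time, so the union of \<open>T\<close> is built by
  induction. \<open>\<alpha>\<close> is arbitrary because the induction hypothesis is also applied
  to an enlarged datum.\<close>

lemma interdeducible_finsert_union:
  assumes "T |\<subseteq>| \<alpha>" and "T \<noteq> {||}"
  shows "\<alpha> \<approx> finsert (ffUnion T) \<alpha>"
  using assms
proof (induction T arbitrary: \<alpha>)
  case empty
  then show ?case by simp
next
  case (insert \<Gamma> T)
  show ?case
  proof (cases "T = {||}")
    case True
    with insert.prems show ?thesis
      by (simp add: finsert_absorb)
  next
    case False
    let ?U = "ffUnion T"
    have T: "T |\<subseteq>| \<alpha>" and \<Gamma>: "finsert \<Gamma> \<alpha> = \<alpha>"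
      using insert.prems by auto
    have "\<alpha> \<approx> finsert ?U \<alpha>"
      using insert.IH[OF T False] .
    also have "finsert ?U \<alpha> \<approx> finsert ?U (finsert (\<Gamma> |\<union>| ?U) \<alpha>)"
      using S_Fus[of \<Gamma> ?U \<alpha>, THEN interdeducible_if_pair_rev] \<Gamma>
      by (metis finsert_commute)
    \<comment> \<open>The auxiliary component \<open>?U\<close> has served its purpose: the
      induction hypothesis for the enlarged datum, read backwards, removes it.\<close>
    also have "finsert ?U (finsert (\<Gamma> |\<union>| ?U) \<alpha>) \<approx> finsert (\<Gamma> |\<union>| ?U) \<alpha>"
      using insert.IH[of "finsert (\<Gamma> |\<union>| ?U) \<alpha>"] T False
      by (metis equivclp_sym fsubset_finsertI2)
    finally show ?thesis by simp
  qed
qed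

text \<open>Fus supplies the total union as an upper bound, Int inserts \<open>\<Sigma>\<close>
  between \<open>\<Gamma>\<close> and this bound, and Fus reversed discards the bound.\<close>

lemma interdeducible_finsert_between:
  assumes "\<Gamma> |\<in>| \<alpha>" and "\<Gamma> |\<subseteq>| \<Sigma>" and "\<Sigma> |\<subseteq>| ffUnion \<alpha>"
  shows "\<alpha> \<approx> finsert \<Sigma> \<alpha>"
proof -
  let ?U = "ffUnion \<alpha>"
  have \<alpha>: "finsert \<Gamma> \<alpha> = \<alpha>" "\<alpha> \<noteq> {||}"
    using assms(1) by auto
  have \<Sigma>: "\<Gamma> |\<union>| \<Sigma> = \<Sigma>" "\<Sigma> |\<union>| ?U = ?U"
    using assms by auto
  have "\<alpha> \<approx> finsert ?U \<alpha>"
    using interdeducible_finsert_union \<alpha>(2) by blast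
  also have "finsert ?U \<alpha> \<approx> finsert ?U (finsert \<Sigma> \<alpha>)"
    using S_Int[of \<Gamma> \<Sigma> ?U \<alpha>, THEN interdeducible_if_pair_rev] \<alpha>(1) \<Sigma>
    by (metis finsert_commute)
  also have "finsert ?U (finsert \<Sigma> \<alpha>) \<approx> finsert \<Sigma> \<alpha>"
  proof -
    \<comment> \<open>Since \<open>\<Sigma>\<close> lies inside \<open>?U\<close>, the total union
      is unchanged, so the bound can still be discarded.\<close>
    have "ffUnion (finsert \<Sigma> \<alpha>) = ?U"
      using \<Sigma>(2) by simp
    then show ?thesis
      using interdeducible_finsert_union[of "finsert \<Sigma> \<alpha>" "finsert \<Sigma> \<alpha>"]
      by (simp add: equivclp_sym)
  qed
  finally show ?thesis .
qed

text \<open>The hypothesis is the criterion of \<open>mem_Cl_iff\<close>, read for components. It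
  persists when \<open>\<alpha>\<close> grows, so the components can be added one by one.\<close>

lemma interdeducible_funion:
  assumes "\<And>\<Sigma>. \<Sigma> |\<in>| T \<Longrightarrow> (\<exists>\<Gamma>. \<Gamma> |\<in>| \<alpha> \<and> \<Gamma> |\<subseteq>| \<Sigma>) \<and> \<Sigma> |\<subseteq>| ffUnion \<alpha>"
  shows "\<alpha> \<approx> T |\<union>| \<alpha>"
  using assms
proof (induction T)
  case empty
  then show ?case by simp
next
  case (insert \<Sigma> T)
  have "\<alpha> \<approx> T |\<union>| \<alpha>"
    using insert by blast
  also obtain \<Gamma> where "\<Gamma> |\<in>| \<alpha>" "\<Gamma> |\<subseteq>| \<Sigma>" "\<Sigma> |\<subseteq>| ffUnion \<alpha>"
    using insert.prems by blast
  then have "T |\<union>| \<alpha> \<approx> finsert \<Sigma> (T |\<union>| \<alpha>)"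
    by (intro interdeducible_finsert_between[of \<Gamma>]) auto
  finally show ?case by simp
qed

section \<open>Reduction to literals\<close>

fun literal :: "'v formula \<Rightarrow> bool" where
  "literal (Var p) = True"
| "literal (Neg (Var p)) = True"
| "literal _ = False"

text \<open>The increment 2 makes De Morgan steps strictly decreasing.\<close>

fun weight :: "'v formula \<Rightarrow> nat" where
  "weight (Var p) = 1"
| "weight (Neg A) = weight A + 1"
| "weight (Conj A B) = weight A + weight B + 2"
| "weight (Disj A B) = weight A + weight B + 2"

abbreviation literal_datum :: "'v datum \<Rightarrow> bool" where
  "literal_datum \<alpha> \<equiv> \<forall>\<Gamma>. \<Gamma> |\<in>| \<alpha> \<longrightarrow> (\<forall>A. A |\<in>| \<Gamma> \<longrightarrow> literal A)"

definition component_weight :: "'v component \<Rightarrow> nat" where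
  "component_weight \<Gamma> = (\<Sum>A\<in>fset \<Gamma>. weight A)"

text \<open>Only an inequality, since \<open>A\<close> may already occur in \<open>\<Gamma>\<close>.
  It bounds the formulas a rule introduces; the formula a rule removes is counted in full by the
  next lemma.\<close>

lemma component_weight_finsert_le: "component_weight (finsert A \<Gamma>) \<le> weight A + component_weight \<Gamma>"
  by (cases "A |\<in>| \<Gamma>") (simp_all add: component_weight_def insert_absorb)

lemma component_weight_finsert: "A |\<notin>| \<Gamma> \<Longrightarrow> component_weight (finsert A \<Gamma>) = weight A + component_weight \<Gamma>"
  by (simp add: component_weight_def)

lemma non_literal_cases:
  assumes "\<not> literal A"
  obtains B C where "A = Conj B C" | B C where "A = Disj B C" | B where "A = Neg (Neg B)"
    | B C where "A = Neg (Disj B C)" | B C where "A = Neg (Conj B C)"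
  using assms by (cases A rule: literal.cases) auto

text \<open>The two outcomes are the non-branching and the branching G-rules. Both are uniform in
  \<open>\<rho>\<close>, so the step can be taken inside any datum.\<close>

lemma G_step:
  assumes "\<not> literal A" and "A |\<notin>| \<Gamma>"
  obtains
    \<Delta> where "component_weight \<Delta> < component_weight (finsert A \<Gamma>)"
      and "\<And>\<rho>. rtdc_pair (finsert (finsert A \<Gamma>) \<rho>) (finsert \<Delta> \<rho>)"
  | \<Delta> \<Theta> where "component_weight \<Delta> < component_weight (finsert A \<Gamma>)"
      and "component_weight \<Theta> < component_weight (finsert A \<Gamma>)"
      and "\<And>\<rho>. rtdc_pair (finsert (finsert A \<Gamma>) \<rho>) (finsert \<Delta> (finsert \<Theta> \<rho>))"
proof -
  note le = component_weight_finsert_le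
  show thesis
    using assms(1)
  proof (cases rule: non_literal_cases)
    case (1 B C)
    show thesis
      using le[of B "finsert C \<Gamma>"] le[of C \<Gamma>] assms(2) 1
      by (intro that(1)[of "finsert B (finsert C \<Gamma>)"])
        (auto simp: component_weight_finsert intro: rtdc_pair.intros)
  next
    case (2 B C)
    show thesis
      using le[of B \<Gamma>] le[of C \<Gamma>] assms(2) 2
      by (intro that(2)[of "finsert B \<Gamma>" "finsert C \<Gamma>"])
        (auto simp: component_weight_finsert intro: rtdc_pair.intros)
  next
    case (3 B)
    show thesis
      using le[of B \<Gamma>] assms(2) 3
      by (intro that(1)[of "finsert B \<Gamma>"])
        (auto simp: component_weight_finsert intro: rtdc_pair.intros)
  next
    case (4 B C)
    show thesis
      using le[of "Neg B" "finsert (Neg C) \<Gamma>"] le[of "Neg C" \<Gamma>] assms(2) 4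
      by (intro that(1)[of "finsert (Neg B) (finsert (Neg C) \<Gamma>)"])
        (auto simp: component_weight_finsert intro: rtdc_pair.intros)
  next
    case (5 B C)
    show thesis
      using le[of "Neg B" \<Gamma>] le[of "Neg C" \<Gamma>] assms(2) 5
      by (intro that(2)[of "finsert (Neg B) \<Gamma>" "finsert (Neg C) \<Gamma>"])
        (auto simp: component_weight_finsert intro: rtdc_pair.intros)
  qed
qed

text \<open>Well-founded induction on the weight. The normal form \<open>\<delta>\<close> is fixed
  before \<open>\<rho>\<close>, so a component is reduced in the same way whatever stands beside
  it.\<close>

lemma component_interdeducible_literal:
  "\<exists>\<delta>. literal_datum \<delta> \<and> (\<forall>\<rho>. finsert \<Gamma> \<rho> \<approx> \<delta> |\<union>| \<rho>)"
proof (induction "component_weight \<Gamma>" arbitrary: \<Gamma> rule: less_induct)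
  case less
  show ?case
  proof (cases "\<forall>A. A |\<in>| \<Gamma> \<longrightarrow> literal A")
    case True
    then show ?thesis
      by (intro exI[of _ "{|\<Gamma>|}"]) auto
  next
    case False
    then obtain A \<Gamma>' where A: "\<not> literal A" "A |\<notin>| \<Gamma>'" and \<Gamma>: "\<Gamma> = finsert A \<Gamma>'"
      by (metis mk_disjoint_finsert)
    from A show ?thesis
    proof (cases rule: G_step)
      case (1 \<Delta>)
      from less[of \<Delta>] 1 \<Gamma> obtain \<delta> where
        \<delta>: "literal_datum \<delta>" "\<And>\<rho>. finsert \<Delta> \<rho> \<approx> \<delta> |\<union>| \<rho>"
        by blast
      have "finsert \<Gamma> \<rho> \<approx> \<delta> |\<union>| \<rho>" for \<rho>
        using r_into_equivclp[of rtdc_pair, OF 1(2)] \<delta>(2) \<Gamma> by (blast intro: equivclp_trans)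
      with \<delta>(1) show ?thesis by blast
    next
      case (2 \<Delta> \<Theta>)
      from less[of \<Delta>] 2 \<Gamma> obtain \<delta> where
        \<delta>: "literal_datum \<delta>" "\<And>\<rho>. finsert \<Delta> \<rho> \<approx> \<delta> |\<union>| \<rho>"
        by blast
      from less[of \<Theta>] 2 \<Gamma> obtain \<theta> where
        \<theta>: "literal_datum \<theta>" "\<And>\<rho>. finsert \<Theta> \<rho> \<approx> \<theta> |\<union>| \<rho>"
        by blast
      have "finsert \<Gamma> \<rho> \<approx> (\<delta> |\<union>| \<theta>) |\<union>| \<rho>" for \<rho>
      proof -
        have "finsert \<Gamma> \<rho> \<approx> finsert \<Delta> (finsert \<Theta> \<rho>)"
          using r_into_equivclp[of rtdc_pair, OF 2(3)] \<Gamma> by blast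
        \<comment> \<open>The two branches are reduced in turn: first with \<open>\<Theta>\<close>
          in the context, then with \<open>\<delta>\<close> in the context.\<close>
        also have "\<dots> \<approx> \<delta> |\<union>| finsert \<Theta> \<rho>"
          using \<delta>(2) .
        also have "\<delta> |\<union>| finsert \<Theta> \<rho> = finsert \<Theta> (\<delta> |\<union>| \<rho>)"
          by simp
        also have "\<dots> \<approx> \<theta> |\<union>| (\<delta> |\<union>| \<rho>)"
          using \<theta>(2) .
        also have "\<theta> |\<union>| (\<delta> |\<union>| \<rho>) = (\<delta> |\<union>| \<theta>) |\<union>| \<rho>"
          by auto
        finally show ?thesis .
      qed
      moreover have "literal_datum (\<delta> |\<union>| \<theta>)"
        using \<delta>(1) \<theta>(1) by auto
      ultimately show ?thesis by blast
    qed
  qed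
qed

lemma datum_interdeducible_literal:
  "\<exists>\<delta>. literal_datum \<delta> \<and> \<alpha> \<approx> \<delta>"
proof -
  \<comment> \<open>The claim is generalised by a context \<open>\<rho>\<close>, so that the
    induction hypothesis applies beside the normal form of \<open>\<Gamma>\<close>; in the end
    \<open>\<rho>\<close> is empty.\<close>
  have "\<exists>\<delta>. literal_datum \<delta> \<and> (\<forall>\<rho>. \<alpha> |\<union>| \<rho> \<approx> \<delta> |\<union>| \<rho>)"
  proof (induction \<alpha>)
    case empty
    show ?case
      by (intro exI[of _ "{||}"]) simp
  next
    case (insert \<Gamma> \<alpha>)
    then obtain \<delta> where \<delta>: "literal_datum \<delta>" "\<And>\<rho>. \<alpha> |\<union>| \<rho> \<approx> \<delta> |\<union>| \<rho>"
      by blast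
    obtain \<gamma> where \<gamma>: "literal_datum \<gamma>" "\<And>\<rho>. finsert \<Gamma> \<rho> \<approx> \<gamma> |\<union>| \<rho>"
      using component_interdeducible_literal by blast
    have "finsert \<Gamma> \<alpha> |\<union>| \<rho> \<approx> (\<gamma> |\<union>| \<delta>) |\<union>| \<rho>" for \<rho>
    proof -
      have "finsert \<Gamma> \<alpha> |\<union>| \<rho> \<approx> \<gamma> |\<union>| (\<alpha> |\<union>| \<rho>)"
        using \<gamma>(2) by simp
      also have "\<gamma> |\<union>| (\<alpha> |\<union>| \<rho>) = \<alpha> |\<union>| (\<gamma> |\<union>| \<rho>)"
        by auto
      also have "\<dots> \<approx> \<delta> |\<union>| (\<gamma> |\<union>| \<rho>)"
        using \<delta>(2) .
      also have "\<delta> |\<union>| (\<gamma> |\<union>| \<rho>) = (\<gamma> |\<union>| \<delta>) |\<union>| \<rho>"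
        by auto
      finally show ?thesis .
    qed
    moreover have "literal_datum (\<gamma> |\<union>| \<delta>)"
      using \<delta>(1) \<gamma>(1) by auto
    ultimately show ?case by blast
  qed
  then show ?thesis
    by (metis funion_fempty_right)
qed

section \<open>Soundness\<close>

text \<open>The lower fusion is a nonempty union, hence contains a member of \<open>X\<close>; the
  upper one lies inside \<open>\<Union>X\<close>. Conversely, \<open>x\<close> itself and the fusion
  of all of \<open>X\<close> serve as bounds.\<close>

lemma mem_Cl_iff: "\<Sigma> \<in> Cl X \<longleftrightarrow> (\<exists>x\<in>X. x \<subseteq> \<Sigma>) \<and> \<Sigma> \<subseteq> \<Union>X"
proof
  assume "\<Sigma> \<in> Cl X"
  then obtain L R where "L \<in> Fus_Cl X" "R \<in> Fus_Cl X" "L \<subseteq> \<Sigma>" "\<Sigma> \<subseteq> R"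
    unfolding Cl_def Int_Cl_def by blast
  moreover from \<open>L \<in> Fus_Cl X\<close> obtain U where "L = \<Union>U" "U \<subseteq> X" "U \<noteq> {}"
    unfolding Fus_Cl_def by blast
  moreover from \<open>R \<in> Fus_Cl X\<close> obtain V where "R = \<Union>V" "V \<subseteq> X"
    unfolding Fus_Cl_def by blast
  ultimately show "(\<exists>x\<in>X. x \<subseteq> \<Sigma>) \<and> \<Sigma> \<subseteq> \<Union>X"
    by (metis Sup_subset_mono Sup_upper ex_in_conv subset_iff)
next
  assume "(\<exists>x\<in>X. x \<subseteq> \<Sigma>) \<and> \<Sigma> \<subseteq> \<Union>X"
  then obtain x where x: "x \<in> X" "x \<subseteq> \<Sigma>" "\<Sigma> \<subseteq> \<Union>X"
    by blast
  have "\<Union>Y \<in> Fus_Cl X" if "Y \<subseteq> X" "Y \<noteq> {}" for Y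
    using that unfolding Fus_Cl_def by blast
  from this[of "{x}"] this[of X] have "x \<in> Fus_Cl X" "\<Union>X \<in> Fus_Cl X"
    using x(1) by auto
  with x(2,3) show "\<Sigma> \<in> Cl X"
    unfolding Cl_def Int_Cl_def by blast
qed

lemma Cl_increasing: "x \<in> X \<Longrightarrow> x \<in> Cl X"
  unfolding mem_Cl_iff by (metis Sup_upper order_refl)

lemma Cl_empty_iff [simp]: "Cl X = {} \<longleftrightarrow> X = {}"
  by (metis Cl_increasing ex_in_conv mem_Cl_iff)

lemma Union_Cl [simp]: "\<Union>(Cl X) = \<Union>X"
proof (intro equalityI subsetI)
  fix s assume "s \<in> \<Union>X"
  then obtain x where "x \<in> X" "s \<in> x" by blast
  then have "x \<in> Cl X" by (simp add: Cl_increasing)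
  with \<open>s \<in> x\<close> show "s \<in> \<Union>(Cl X)" by blast
qed (use mem_Cl_iff[of _ X] in blast)

text \<open>The upward closure of \<open>X\<close> as a predicate. Together with
  \<open>\<Union>X\<close> it determines \<open>Cl X\<close>, and both are easy to compute for the
  connectives.\<close>

definition up :: "'s set set \<Rightarrow> 's set \<Rightarrow> bool" where
  "up X \<Sigma> \<longleftrightarrow> (\<exists>x\<in>X. x \<subseteq> \<Sigma>)"

lemma up_Cl [simp]: "up (Cl X) \<Sigma> \<longleftrightarrow> up X \<Sigma>"
proof
  assume "up (Cl X) \<Sigma>"
  then show "up X \<Sigma>"
    unfolding up_def by (metis mem_Cl_iff order_trans)
next
  assume "up X \<Sigma>"
  then obtain x where "x \<in> X" "x \<subseteq> \<Sigma>" unfolding up_def by blast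
  then have "x \<in> Cl X" by (simp add: Cl_increasing)
  with \<open>x \<subseteq> \<Sigma>\<close> show "up (Cl X) \<Sigma>" unfolding up_def by blast
qed

lemma up_Un [simp]: "up (X \<union> Y) \<Sigma> \<longleftrightarrow> up X \<Sigma> \<or> up Y \<Sigma>"
  by (auto simp: up_def)

lemma up_pairwise_Un [simp]: "up {x \<union> y | x y. x \<in> X \<and> y \<in> Y} \<Sigma> \<longleftrightarrow> up X \<Sigma> \<and> up Y \<Sigma>"
proof -
  have "up {x \<union> y | x y. x \<in> X \<and> y \<in> Y} \<Sigma> \<longleftrightarrow> (\<exists>x\<in>X. \<exists>y\<in>Y. x \<union> y \<subseteq> \<Sigma>)"
    unfolding up_def by blast
  then show ?thesis
    unfolding Un_subset_iff up_def by blast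
qed

lemma pairwise_Un_empty_iff: "{x \<union> y | x y. x \<in> X \<and> y \<in> Y} = {} \<longleftrightarrow> X = {} \<or> Y = {}"
  by blast

text \<open>A member of \<open>X\<close> shows up on the left only with a partner from
  \<open>Y\<close>, and vice versa; hence the two assumptions.\<close>

lemma Union_pairwise_Un:
  assumes "X \<noteq> {}" and "Y \<noteq> {}"
  shows "\<Union>{x \<union> y | x y. x \<in> X \<and> y \<in> Y} = \<Union>X \<union> \<Union>Y"
proof -
  have "\<Union>{x \<union> y | x y. x \<in> X \<and> y \<in> Y} = (\<Union>x\<in>X. \<Union>y\<in>Y. x \<union> y)"
    by blast
  also have "\<dots> = \<Union>X \<union> \<Union>Y"
    using assms by auto
  finally show ?thesis .
qed

lemma up_choice_Un:
  "up {\<Union>a\<in>I. f a | f. \<forall>a\<in>I. f a \<in> X a} \<Sigma> \<longleftrightarrow> (\<forall>a\<in>I. up (X a) \<Sigma>)"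
proof
  assume "up {\<Union>a\<in>I. f a | f. \<forall>a\<in>I. f a \<in> X a} \<Sigma>"
  then show "\<forall>a\<in>I. up (X a) \<Sigma>"
    unfolding up_def by blast
next
  assume "\<forall>a\<in>I. up (X a) \<Sigma>"
  then obtain f where "\<forall>a\<in>I. f a \<in> X a \<and> f a \<subseteq> \<Sigma>"
    unfolding up_def by metis
  then show "up {\<Union>a\<in>I. f a | f. \<forall>a\<in>I. f a \<in> X a} \<Sigma>"
    unfolding up_def by blast
qed

lemma Union_choice_Un:
  assumes "\<And>a. a \<in> I \<Longrightarrow> X a \<noteq> {}"
  shows "\<Union>{\<Union>a\<in>I. f a | f. \<forall>a\<in>I. f a \<in> X a} = (\<Union>a\<in>I. \<Union>(X a))"
proof (intro equalityI subsetI)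
  fix s assume "s \<in> (\<Union>a\<in>I. \<Union>(X a))"
  then obtain a x where ax: "a \<in> I" "x \<in> X a" "s \<in> x"
    by blast
  have "\<forall>a\<in>I. \<exists>x. x \<in> X a"
    using assms by blast
  then obtain f where "\<forall>a\<in>I. f a \<in> X a"
    by metis
  \<comment> \<open>An arbitrary choice function is redirected at \<open>a\<close> to
    \<open>x\<close>, the set that contributes the point \<open>s\<close>.\<close>
  with ax(2) have "\<forall>b\<in>I. (f(a := x)) b \<in> X b"
    by simp
  then have "(\<Union>b\<in>I. (f(a := x)) b) \<in> {\<Union>a\<in>I. f a | f. \<forall>a\<in>I. f a \<in> X a}"
    by (intro CollectI exI[of _ "f(a := x)"] conjI refl)
  moreover have "s \<in> (\<Union>b\<in>I. (f(a := x)) b)"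
    using ax by (intro UN_I[of a]) simp_all
  ultimately show "s \<in> \<Union>{\<Union>a\<in>I. f a | f. \<forall>a\<in>I. f a \<in> X a}"
    by (intro UnionI)
qed (clarsimp, blast)

section \<open>Evaluation of data in regular models\<close>

text \<open>Both polarities are proved together because \<open>Neg\<close> exchanges them. The
  result supplies the nonemptiness assumptions of the lemmas on unions.\<close>

lemma sigma_nonempty:
  assumes "regular_model S \<sigma>"
  shows "sigma_pos \<sigma> A \<noteq> {}" and "sigma_neg \<sigma> A \<noteq> {}"
  using assms by (induction A)
    (simp_all add: regular_model_def regular_set_def pairwise_Un_empty_iff del: Collect_empty_eq)

text \<open>The inner closures disappear because \<open>Cl\<close> changes neither the upward
  closure nor the union.\<close>

lemma mem_sigma_datum_iff:
  assumes "regular_model S \<sigma>"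
  shows "\<Sigma> \<in> sigma_datum \<sigma> \<alpha> \<longleftrightarrow>
    (\<exists>\<Gamma>\<in>fset \<alpha>. \<forall>A\<in>fset \<Gamma>. up (sigma_pos \<sigma> A) \<Sigma>) \<and>
    \<Sigma> \<subseteq> (\<Union>\<Gamma>\<in>fset \<alpha>. \<Union>A\<in>fset \<Gamma>. \<Union>(sigma_pos \<sigma> A))"
proof -
  have "up (sigma_component \<sigma> \<Gamma>) \<Sigma> \<longleftrightarrow> (\<forall>A\<in>fset \<Gamma>. up (sigma_pos \<sigma> A) \<Sigma>)" for \<Gamma>
    unfolding sigma_component_def up_Cl by (rule up_choice_Un)
  moreover have "\<Union>(sigma_component \<sigma> \<Gamma>) = (\<Union>A\<in>fset \<Gamma>. \<Union>(sigma_pos \<sigma> A))" for \<Gamma>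
    unfolding sigma_component_def Union_Cl
    by (rule Union_choice_Un) (rule sigma_nonempty[OF assms])
  moreover have "up (\<Union>\<Gamma>\<in>fset \<alpha>. X \<Gamma>) \<Sigma> \<longleftrightarrow> (\<exists>\<Gamma>\<in>fset \<alpha>. up (X \<Gamma>) \<Sigma>)" for X
    unfolding up_def by blast
  moreover have "\<Union>(\<Union>\<Gamma>\<in>fset \<alpha>. X \<Gamma>) = (\<Union>\<Gamma>\<in>fset \<alpha>. \<Union>(X \<Gamma>))" for X :: "_ \<Rightarrow> 'a set set"
    by blast
  ultimately show ?thesis
    unfolding sigma_datum_def mem_Cl_iff up_def[symmetric] by simp
qed

text \<open>Each half of \<open>mem_sigma_datum_iff\<close> is preserved separately. The component
  added by Fus or Int contains \<open>\<Gamma>\<close>, so it does not weaken the disjunction, and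
  it is covered by the other components, so it does not enlarge the union.\<close>

lemma rtdc_pair_sound:
  assumes "regular_model S \<sigma>" and "rtdc_pair \<alpha> \<beta>"
  shows "sigma_datum \<sigma> \<alpha> = sigma_datum \<sigma> \<beta>"
proof -
  note ne = sigma_nonempty[OF assms(1)]
  have "(\<exists>\<Gamma>\<in>fset \<alpha>. \<forall>A\<in>fset \<Gamma>. up (sigma_pos \<sigma> A) \<Sigma>) \<longleftrightarrow>
      (\<exists>\<Gamma>\<in>fset \<beta>. \<forall>A\<in>fset \<Gamma>. up (sigma_pos \<sigma> A) \<Sigma>)" for \<Sigma>
    using assms(2) by cases (simp_all add: ball_Un, blast+)
  moreover have "(\<Union>\<Gamma>\<in>fset \<alpha>. \<Union>A\<in>fset \<Gamma>. \<Union>(sigma_pos \<sigma> A)) =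
      (\<Union>\<Gamma>\<in>fset \<beta>. \<Union>A\<in>fset \<Gamma>. \<Union>(sigma_pos \<sigma> A))"
    using assms(2) by cases (simp_all add: Union_pairwise_Un ne, blast+)
  ultimately show ?thesis
    by (intro set_eqI) (simp only: mem_sigma_datum_iff[OF assms(1)])
qed

lemma interdeducible_sound:
  assumes "regular_model S \<sigma>" and "\<alpha> \<approx> \<beta>"
  shows "sigma_datum \<sigma> \<alpha> = sigma_datum \<sigma> \<beta>"
  using assms(2)
proof (induction rule: equivclp_induct)
  case (step \<beta> \<gamma>)
  then show ?case
    using rtdc_pair_sound[OF assms(1)] by metis
qed simp

section \<open>The canonical model\<close>

lemma regular_set_singleton: "regular_set {x}"
proof -
  have "Fus_Cl {x} = {x}"
    unfolding Fus_Cl_def by (simp add: subset_singleton_iff conj_disj_distribR ex_disj_distrib cong: conj_cong)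
  moreover have "Int_Cl {x} = {x}"
    unfolding Int_Cl_def by blast
  ultimately show ?thesis
    by (simp add: regular_set_def)
qed

text \<open>Only finitely many literals must receive distinct states, so any infinite
  \<open>'s\<close> suffices, whatever the size of \<open>'v\<close>.\<close>

lemma canonical_model_exists:
  fixes F :: "'v formula set"
  assumes "infinite (UNIV :: 's set)" and "finite F" and "\<And>A. A \<in> F \<Longrightarrow> literal A"
  obtains g :: "'v formula \<Rightarrow> 's" and \<sigma> where "inj_on g F" and "regular_model UNIV \<sigma>"
    and "\<And>A. A \<in> F \<Longrightarrow> sigma_pos \<sigma> A = {{g A}}"
proof -
  define V where "V = (\<Union>A\<in>F. set_formula A)"
  \<comment> \<open>Both signs of each variable are included, even if only one occurs in
    \<open>F\<close>, because the two sides of a bilateral proposition must differ.\<close>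
  define L where "L = Var ` V \<union> (\<lambda>p. Neg (Var p)) ` V"
  have set_formula_finite: "finite (set_formula A)" for A :: "'v formula"
    by (induction A) auto
  then have "finite L"
    using assms(2) by (auto simp: L_def V_def)
  moreover obtain B :: "'s set" where "finite B" "card L = card B"
    using infinite_arbitrarily_large[OF assms(1)] by metis
  ultimately obtain g :: "'v formula \<Rightarrow> 's" where g: "inj_on g L"
    using finite_same_card_bij bij_betw_imp_inj_on by metis
  \<comment> \<open>Variables outside \<open>V\<close> receive two arbitrary regular sets that
    differ; \<open>UNIV\<close> is not \<open>{}\<close> since types are nonempty.\<close>
  define \<sigma> where "\<sigma> p = (if p \<in> V then ({{g (Var p)}}, {{g (Neg (Var p))}}) else ({{}}, {UNIV}))" for p
  have "F \<subseteq> L"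
  proof
    fix A assume "A \<in> F"
    then have "literal A" "set_formula A \<subseteq> V"
      using assms(3) by (auto simp: V_def)
    then show "A \<in> L"
      by (cases A rule: literal.cases) (simp_all add: L_def)
  qed
  have "g (Var p) \<noteq> g (Neg (Var p))" if "p \<in> V" for p
    using inj_onD[OF g, of "Var p" "Neg (Var p)"] that by (auto simp: L_def)
  then have "regular_model UNIV \<sigma>"
    by (auto simp: regular_model_def bilateral_proposition_def \<sigma>_def regular_set_singleton)
  moreover have "sigma_pos \<sigma> A = {{g A}}" if "A \<in> L" for A
    using that by (auto simp: L_def \<sigma>_def)
  ultimately show thesis
    using that[of g \<sigma>] inj_on_subset[OF g \<open>F \<subseteq> L\<close>] \<open>F \<subseteq> L\<close> by blast
qed

lemma inj_on_image_subset_iff: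
  assumes "inj_on f C" and "A \<subseteq> C" and "B \<subseteq> C"
  shows "f ` A \<subseteq> f ` B \<longleftrightarrow> A \<subseteq> B"
proof -
  have "f a \<in> f ` B \<longleftrightarrow> a \<in> B" if "a \<in> A" for a
    using that assms by (intro inj_on_image_mem_iff) blast+
  then show ?thesis
    unfolding image_subset_iff by blast
qed

section \<open>Completeness\<close>

text \<open>One canonical model, built for the literals of both data, decides the matter: equal
  denotations there let each datum absorb the other.\<close>

lemma literal_data_interdeducible:
  fixes \<alpha> \<beta> :: "'v datum"
  assumes "infinite (UNIV :: 's set)" and "RT_equiv TYPE('s) \<alpha> \<beta>"
    and "literal_datum \<alpha>" and "literal_datum \<beta>"
  shows "\<alpha> \<approx> \<beta>"
proof -
  define F where "F = (\<Union>\<Gamma>\<in>fset (\<alpha> |\<union>| \<beta>). fset \<Gamma>)"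
  have "literal A" if "A \<in> F" for A
    using that assms(3,4) by (auto simp: F_def)
  moreover have "finite F"
    by (simp add: F_def)
  ultimately obtain g :: "'v formula \<Rightarrow> 's" and \<sigma> where g: "inj_on g F"
    and \<sigma>: "regular_model UNIV \<sigma>" "\<And>A. A \<in> F \<Longrightarrow> sigma_pos \<sigma> A = {{g A}}"
    using canonical_model_exists[OF assms(1), of F] by metis
  have mem_F: "A \<in> F" if "A |\<in>| \<Gamma>" "\<Gamma> |\<in>| \<alpha> |\<union>| \<beta>" for A \<Gamma>
    using that by (auto simp: F_def)
  \<comment> \<open>Each literal has exactly one verifier, so \<open>up\<close> becomes an inclusion
    of images under \<open>g\<close>.\<close>
  have mem_iff: "\<Sigma> \<in> sigma_datum \<sigma> \<gamma> \<longleftrightarrow>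
      (\<exists>\<Gamma>\<in>fset \<gamma>. g ` fset \<Gamma> \<subseteq> \<Sigma>) \<and> \<Sigma> \<subseteq> g ` fset (ffUnion \<gamma>)"
    if "\<gamma> |\<subseteq>| \<alpha> |\<union>| \<beta>" for \<gamma> \<Sigma>
  proof -
    have pos: "sigma_pos \<sigma> A = {{g A}}" if "A \<in> fset \<Gamma>" "\<Gamma> \<in> fset \<gamma>" for A \<Gamma>
      using that \<open>\<gamma> |\<subseteq>| \<alpha> |\<union>| \<beta>\<close> by (intro \<sigma>(2) mem_F) auto
    have "(\<forall>A\<in>fset \<Gamma>. up (sigma_pos \<sigma> A) \<Sigma>) \<longleftrightarrow> g ` fset \<Gamma> \<subseteq> \<Sigma>" if "\<Gamma> \<in> fset \<gamma>" for \<Gamma>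
      using pos that by (simp add: up_def image_subset_iff)
    moreover have "(\<Union>\<Gamma>\<in>fset \<gamma>. \<Union>A\<in>fset \<Gamma>. \<Union>(sigma_pos \<sigma> A)) = g ` fset (ffUnion \<gamma>)"
      using pos by (simp add: ffUnion.rep_eq image_UN UNION_singleton_eq_range)
    ultimately show ?thesis
      unfolding mem_sigma_datum_iff[OF \<sigma>(1)] by (simp cong: bex_cong)
  qed
  have absorb: "\<gamma> \<approx> \<delta> |\<union>| \<gamma>"
    if sub: "\<gamma> |\<subseteq>| \<alpha> |\<union>| \<beta>" "\<delta> |\<subseteq>| \<alpha> |\<union>| \<beta>" and eq: "sigma_datum \<sigma> \<gamma> = sigma_datum \<sigma> \<delta>" for \<gamma> \<delta>
  proof (rule interdeducible_funion)
    fix \<Delta> assume \<Delta>: "\<Delta> |\<in>| \<delta>"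
    \<comment> \<open>The image of \<open>\<Delta>\<close> lies in the denotation of its own datum,
      hence in that of \<open>\<gamma>\<close>. Injectivity of \<open>g\<close> then carries the
      resulting inclusions back to components.\<close>
    then have "g ` fset \<Delta> \<in> sigma_datum \<sigma> \<gamma>"
      unfolding eq mem_iff[OF sub(2)] by (auto simp: ffUnion.rep_eq)
    then obtain \<Gamma> where \<Gamma>: "\<Gamma> |\<in>| \<gamma>" "g ` fset \<Gamma> \<subseteq> g ` fset \<Delta>"
      and U: "g ` fset \<Delta> \<subseteq> g ` fset (ffUnion \<gamma>)"
      unfolding mem_iff[OF sub(1)] by blast
    have F: "fset \<Gamma> \<subseteq> F" "fset \<Delta> \<subseteq> F" "fset (ffUnion \<gamma>) \<subseteq> F"
      using \<Gamma>(1) \<Delta> sub by (auto simp: ffUnion.rep_eq intro: mem_F)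
    have "\<Gamma> |\<subseteq>| \<Delta>" "\<Delta> |\<subseteq>| ffUnion \<gamma>"
      using \<Gamma>(2) U F by (simp_all add: inj_on_image_subset_iff[OF g] less_eq_fset.rep_eq)
    with \<Gamma>(1) show "(\<exists>\<Gamma>. \<Gamma> |\<in>| \<gamma> \<and> \<Gamma> |\<subseteq>| \<Delta>) \<and> \<Delta> |\<subseteq>| ffUnion \<gamma>"
      by blast
  qed
  have "sigma_datum \<sigma> \<alpha> = sigma_datum \<sigma> \<beta>"
    using assms(2) \<sigma>(1) unfolding RT_equiv_def by blast
  then have "\<alpha> \<approx> \<beta> |\<union>| \<alpha>" "\<beta> \<approx> \<alpha> |\<union>| \<beta>"
    by (intro absorb; simp)+
  then show ?thesis
    by (metis equivclp_sym equivclp_trans funion_commute)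
qed

theorem mainTheorem5:
  fixes \<alpha> \<beta> :: "'v datum"
  assumes "infinite (UNIV :: 's set)"
    and "RT_equiv TYPE('s) \<alpha> \<beta>"
  shows "rtdc_deducible \<alpha> \<beta>"
proof -
  obtain \<alpha>' \<beta>' where \<alpha>': "literal_datum \<alpha>'" "\<alpha> \<approx> \<alpha>'" and \<beta>': "literal_datum \<beta>'" "\<beta> \<approx> \<beta>'"
    using datum_interdeducible_literal by metis
  \<comment> \<open>Soundness enters the completeness proof here: it transfers the equivalence to
    the literal normal forms.\<close>
  have "RT_equiv TYPE('s) \<alpha>' \<beta>'"
    using assms(2) interdeducible_sound[OF _ \<alpha>'(2)] interdeducible_sound[OF _ \<beta>'(2)]
    unfolding RT_equiv_def by metis
  then have "\<alpha>' \<approx> \<beta>'"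
    using literal_data_interdeducible assms(1) \<alpha>'(1) \<beta>'(1) by blast
  then have "\<alpha> \<approx> \<beta>"
    using \<alpha>'(2) \<beta>'(2) by (meson equivclp_sym equivclp_trans)
  then show ?thesis
    by (rule rtdc_deducible_if_interdeducible)
qed

end
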